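(* Let $p\in\mathbb{T}^{\binom{[n]}{m}}$ be a tropical Plücker vector of rank $m$ with underlying matroid $M$, and let $B$ be any basis of $M$. Then the local tropical linear space $L(p)_B$ is combinatorially dual to the mixed subdivision $\mathcal{M}_B$ of the Minkowski sum $\sum_{j\in[n]\setminus B}\Delta_{I_j}$.
   Context: Notation: $m\le n$ are nonnegative integers; $[n]=\{1,\dots,n\}$; $\binom{[n]}{m}$ is the set of $m$-element subsets of $[n]$; $\mathbb{T}=\mathbb{R}\cup\{\infty\}$; $S\cup i$, $S-i$ mean $S\cup\{i\}$, $S\setminus\{i\}$; $e_S=\sum_{i\in S}e_i$. Tropical Plücker vector of rank $m$: a vector $p\in\mathbb{T}^{\binom{[n]}{m}}$ such that for all $S,T\subseteq[n]$ with $|S|=m-1$, $|T|=m+1$, the minimum $\min_{i\in T\setminus S}(p_{S\cup i}+p_{T-i})$ is achieved for at least two values of $i$ or equals $\infty$. Its support $\{A:p_A\ne\infty\}$ is the set of bases of a matroid $M$ on $[n]$, the underlying matroid of $p$. For $S\subseteq[n]$ with $|S|=m+1$ let $c_S\in\mathbb{T}^n$ be given by $(c_S)_i=p_{S-i}$ if $i\in S$, $\infty$ otherwise. The circuits of $p$ are the vectors $c_S+\lambda(1,\dots,1)$, $\lambda\in\mathbb{R}$, with $c_S\ne(\infty,\dots,\infty)$. Vectors $x,y\in\mathbb{T}^n$ are tropically orthogonal if $\min_i(x_i+y_i)$ is achieved at least twice or equals $\infty$. The tropical linear space $L(p)\subseteq\mathbb{T}^n$ is the set of vectors tropically orthogonal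 to all circuits of $p$. For a basis $A$ of $M$ and $v\in\mathbb{R}^n$, let $w_p(v,A)=-p_A+\sum_{i\in A}v_i$. The bases of $M$ maximizing $w_p(v,\cdot)$ are the bases of a matroid $M_v$. Set $\Sigma_B=\{v\in\mathbb{R}^n: B\text{ is a basis of }M_v\}$ and $L(p)_B=L(p)\cap\Sigma_B$. The set $L(p)_B$ is a polyhedral complex whose cells are the closures of the sets $\{v'\in L(p)_B: M_{v'}=M_v\}$, $v\in L(p)_B$, ordered by inclusion. For a matroid $N$, $\Gamma(N)$ is the convex hull of the vectors $e_A$, $A$ a basis of $N$. The regular subdivision $\mathcal{D}_p$ of $\Gamma(M)$ induced by $p$ is the one whose faces are the polytopes $\Gamma(M_v)$, $v\in\mathbb{R}^n$. The vertex figure is $\Gamma_B=\Gamma(M)\cap\{x:\sum_{i\in B}x_i=m-1\}$, the convex hull of the vectors $e_A$ with $A$ a basis of $M$ and $|A\setminus B|=1$. The local subdivision $\mathcal{D}_B$ of $\Gamma_B$ is obtained by intersecting the faces of $\mathcal{D}_p$ with $\Gamma_B$. For $j\in[n]\setminus B$, $I_j=\{i\in B: B-i\cup j\text{ is a basis of }M\}$, and $\Delta_{I}=\mathrm{conv}\{e_i:i\in I\}\subseteq\mathbb{R}^B$. Let $\varphi:\mathbb{R}^n\to\mathbb{R}^n$ be the affine isomorphism with $\varphi(x)_i=1-x_i$ for $i\in B$ and $\varphi(x)_j=x_j$ for $j\notin B$; it sends $e_B-e_i+e_j$ to $e_i+e_j$ and hence $\Gamma_B$ to the Cayley embedding $\mathrm{conv}\bigcup_{j\in[n]\setminus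 B}(e_j+\Delta_{I_j})$. The mixed subdivision $\mathcal{M}_B$ of $\sum_{j\in[n]\setminus B}\Delta_{I_j}$ is obtained from $\mathcal{D}_B$ by the Cayley trick: intersect the faces $\varphi(G)$, $G$ a face of $\mathcal{D}_B$, with the affine subspace of $\mathbb{R}^n$ in which all coordinates indexed by $[n]\setminus B$ equal $\frac{1}{n-m}$, identify this subspace with $\mathbb{R}^B$, and scale by $n-m$. That is, its nonempty faces are the nonempty sets of the form $\{y\in\mathbb{R}^B:\tfrac{1}{n-m}(y,1,\dots,1)\in\varphi(G)\}$, where $(y,1,\dots,1)$ has $B$-coordinates $y$ and all coordinates indexed by $[n]\setminus B$ equal to $1$. "Combinatorially dual" means that there is an inclusion-reversing bijection (an anti-isomorphism of face posets) between the cells of $L(p)_B$ and the nonempty faces of $\mathcal{M}_B$. *)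

theory Defs
  imports "HOL-Analysis.Analysis" "HOL-Library.Set_Algebras"
begin

text \<open>
  The ground set $[n]$ is a finite type \<open>'n\<close>, so $n$ is \<open>CARD('n)\<close>. The tropical semiring
  $\mathbb{T} = \mathbb{R} \cup \{\infty\}$ is \<open>ereal\<close> without $-\infty$. A vector in
  $\mathbb{T}^{\binom{[n]}{m}}$ is a function \<open>p :: 'n set \<Rightarrow> ereal\<close> of which only the values
  at $m$-element sets are ever used. A matroid on $[n]$ is given by its set of bases.
\<close>

definition tropical :: "ereal set" where
  "tropical = {x. x \<noteq> -\<infinity>}"

definition min_twice_or_infinite :: "'i set \<Rightarrow> ('i \<Rightarrow> ereal) \<Rightarrow> bool" where
  "min_twice_or_infinite I f \<longleftrightarrow>
     (INF i\<in>I. f i) = \<infinity> \<or>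
     (\<exists>i\<in>I. \<exists>j\<in>I. i \<noteq> j \<and> f i = (INF k\<in>I. f k) \<and> f j = (INF k\<in>I. f k))"

definition tropical_pluecker :: "nat \<Rightarrow> ('n::finite set \<Rightarrow> ereal) \<Rightarrow> bool" where
  "tropical_pluecker m p \<longleftrightarrow>
     (\<forall>A. card A = m \<longrightarrow> p A \<in> tropical) \<and>
     (\<forall>S T. card S + 1 = m \<and> card T = m + 1 \<longrightarrow>
        min_twice_or_infinite (T - S) (\<lambda>i. p (insert i S) + p (T - {i})))"

definition matroid_bases :: "nat \<Rightarrow> ('n::finite set \<Rightarrow> ereal) \<Rightarrow> 'n set set" where
  "matroid_bases m p = {A. card A = m \<and> p A \<noteq> \<infinity>}"


subsection \<open>The tropical linear space\<close>

definition circuit_vec :: "('n::finite set \<Rightarrow> ereal) \<Rightarrow> 'n set \<Rightarrow> ereal ^ 'n" where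
  "circuit_vec p S = (\<chi> i. if i \<in> S then p (S - {i}) else \<infinity>)"

definition circuits :: "nat \<Rightarrow> ('n::finite set \<Rightarrow> ereal) \<Rightarrow> (ereal ^ 'n) set" where
  "circuits m p =
     {(\<chi> i. circuit_vec p S $ i + ereal l) | S l.
        card S = m + 1 \<and> circuit_vec p S \<noteq> (\<chi> i. \<infinity>)}"

definition tropically_orthogonal :: "ereal ^ 'n::finite \<Rightarrow> ereal ^ 'n \<Rightarrow> bool" where
  "tropically_orthogonal x y \<longleftrightarrow> min_twice_or_infinite UNIV (\<lambda>i. x $ i + y $ i)"

definition tropical_linear_space :: "nat \<Rightarrow> ('n::finite set \<Rightarrow> ereal) \<Rightarrow> (ereal ^ 'n) set" where
  "tropical_linear_space m p =
     {x. (\<forall>i. x $ i \<in> tropical) \<and> (\<forall>c\<in>circuits m p. tropically_orthogonal x c)}"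

text \<open>Only used for bases \<open>A\<close>, where \<open>p A\<close> is finite.\<close>

definition weight :: "('n::finite set \<Rightarrow> ereal) \<Rightarrow> real ^ 'n \<Rightarrow> 'n set \<Rightarrow> real" where
  "weight p v A = - real_of_ereal (p A) + (\<Sum>i\<in>A. v $ i)"

definition initial_bases :: "nat \<Rightarrow> ('n::finite set \<Rightarrow> ereal) \<Rightarrow> real ^ 'n \<Rightarrow> 'n set set" where
  "initial_bases m p v =
     {A \<in> matroid_bases m p. \<forall>A'\<in>matroid_bases m p. weight p v A' \<le> weight p v A}"

definition basis_region :: "nat \<Rightarrow> ('n::finite set \<Rightarrow> ereal) \<Rightarrow> 'n set \<Rightarrow> (real ^ 'n) set" where
  "basis_region m p B = {v. B \<in> initial_bases m p v}"

definition local_tropical_linear_space ::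
    "nat \<Rightarrow> ('n::finite set \<Rightarrow> ereal) \<Rightarrow> 'n set \<Rightarrow> (real ^ 'n) set" where
  "local_tropical_linear_space m p B =
     {v. (\<chi> i. ereal (v $ i)) \<in> tropical_linear_space m p} \<inter> basis_region m p B"

definition local_cells :: "nat \<Rightarrow> ('n::finite set \<Rightarrow> ereal) \<Rightarrow> 'n set \<Rightarrow> (real ^ 'n) set set" where
  "local_cells m p B =
     {closure {v' \<in> local_tropical_linear_space m p B. initial_bases m p v' = initial_bases m p v}
      | v. v \<in> local_tropical_linear_space m p B}"


subsection \<open>The subdivisions\<close>

definition indicator_vec :: "'n::finite set \<Rightarrow> real ^ 'n" where
  "indicator_vec S = (\<Sum>i\<in>S. axis i 1)"

definition matroid_polytope :: "'n::finite set set \<Rightarrow> (real ^ 'n) set" where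
  "matroid_polytope N = convex hull (indicator_vec ` N)"

definition regular_subdivision :: "nat \<Rightarrow> ('n::finite set \<Rightarrow> ereal) \<Rightarrow> (real ^ 'n) set set" where
  "regular_subdivision m p = {matroid_polytope (initial_bases m p v) | v. True}"

definition vertex_figure :: "nat \<Rightarrow> ('n::finite set \<Rightarrow> ereal) \<Rightarrow> 'n set \<Rightarrow> (real ^ 'n) set" where
  "vertex_figure m p B =
     matroid_polytope (matroid_bases m p) \<inter> {x. (\<Sum>i\<in>B. x $ i) = real m - 1}"

definition local_subdivision ::
    "nat \<Rightarrow> ('n::finite set \<Rightarrow> ereal) \<Rightarrow> 'n set \<Rightarrow> (real ^ 'n) set set" where
  "local_subdivision m p B = {G \<inter> vertex_figure m p B | G. G \<in> regular_subdivision m p}"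

definition exchange_set :: "nat \<Rightarrow> ('n::finite set \<Rightarrow> ereal) \<Rightarrow> 'n set \<Rightarrow> 'n \<Rightarrow> 'n set" where
  "exchange_set m p B j = {i \<in> B. insert j (B - {i}) \<in> matroid_bases m p}"

definition coord_simplex :: "'n::finite set \<Rightarrow> (real ^ 'n) set" where
  "coord_simplex I = convex hull ((\<lambda>i. axis i 1) ` I)"

definition cayley_map :: "'n::finite set \<Rightarrow> real ^ 'n \<Rightarrow> real ^ 'n" where
  "cayley_map B x = (\<chi> i. if i \<in> B then 1 - x $ i else x $ i)"

text \<open>
  $\mathbb{R}^B$ is the coordinate subspace of vectors vanishing off \<open>B\<close>, so that the point
  $(y,1,\dots,1)$ is \<open>y + indicator_vec (- B)\<close>. For $m = n$ there is no Cayley trick (the scaling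
  factor $1/(n-m)$ is undefined): the Minkowski sum has no summands, hence is $\{0\}$, and
  its subdivision is the trivial one.
\<close>

definition mixed_subdivision ::
    "nat \<Rightarrow> ('n::finite set \<Rightarrow> ereal) \<Rightarrow> 'n set \<Rightarrow> (real ^ 'n) set set" where
  "mixed_subdivision m p B =
     (if m = CARD('n) then {\<Sum>j\<in>- B. coord_simplex (exchange_set m p B j)}
      else {{y. (\<forall>j. j \<notin> B \<longrightarrow> y $ j = 0) \<and>
                (1 / (real CARD('n) - real m)) *\<^sub>R (y + indicator_vec (- B)) \<in> cayley_map B ` G}
            | G. G \<in> local_subdivision m p B})"

definition combinatorially_dual :: "'a set set \<Rightarrow> 'b set set \<Rightarrow> bool" where
  "combinatorially_dual X Y \<longleftrightarrow>
     (\<exists>f. bij_betw f X Y \<and> (\<forall>C\<in>X. \<forall>D\<in>X. C \<subseteq> D \<longleftrightarrow> f D \<subseteq> f C))"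

end

theory Submission
  imports Defs
begin

text \<open>
  For a vector \<open>v\<close> call $(i, j) \in B \times ([n] \setminus B)$ an exchange edge of \<open>v\<close> if $B - i + j$
  is a basis of $M_v$, and let $E_v$ be the set of these edges. Both posets are described by the
  sets $E_v$ for \<open>v\<close> in the local tropical linear space, once with reversed inclusion and once
  with inclusion.

  A vector \<open>v\<close> with \<open>B\<close> a basis of $M_v$ lies in the tropical linear space if and only if every
  $j \notin B$ is covered by an edge in $E_v$, that is, if $M_v$ is loopless
  (\<open>ereal_vec_in_tropical_linear_space_iff\<close>). The cell of \<open>v\<close> is the closure of the set of
  vectors with initial matroid $M_v$, and shrinking this cell amounts to enlarging the set of bases
  of $M_v$ (\<open>closure_initial_bases_region_subset_iff\<close>). By symmetric exchange, $e_A - e_B$ is in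
  the cone of the vectors $e_j - e_i$, $(i, j) \in E_v$, for each basis $A$ of $M_v$; so comparing
  initial matroids that contain \<open>B\<close> is the same as comparing their exchange edges
  (\<open>initial_bases_subset_iff\<close>).

  On the other side, this cone description shows that the vertex figure cuts $\Gamma(M_v)$ in
  the convex hull of the vectors $e_{B-i+j}$ with $(i, j) \in E_v$
  (\<open>matroid_polytope_Int_vertex_figure\<close>), and the Cayley trick turns this polytope into the
  Minkowski sum of the simplices $\Delta_{E_v(j)}$ (\<open>cayley_slice_eq_mixed_cell\<close>). This sum is
  nonempty exactly if $E_v$ covers every $j \notin B$, so the nonempty faces are indexed by the
  same vectors as the cells. Finally, inclusion of mixed cells forces inclusion of the edge sets,
  because all of them are selected by one height function $p_{B-i+j} - p_B$
  (\<open>mixed_cell_subset_iff\<close>).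

  The tropical Pluecker relations enter through the exchange property \<open>valuated_exchange\<close>.
\<close>

section \<open>Indicator vectors and exchanges at a basis\<close>

definition exchange :: "'a set \<Rightarrow> 'a \<times> 'a \<Rightarrow> 'a set" where
  "exchange B e = insert (snd e) (B - {fst e})"

lemma indicator_vec_nth: "indicator_vec S $ k = (if k \<in> S then 1 else 0)"
  by (simp add: indicator_vec_def axis_def)

lemma inner_indicator_vec: "v \<bullet> indicator_vec S = (\<Sum>i\<in>S. v $ i)"
  by (simp add: indicator_vec_def inner_sum_right inner_axis)

lemma indicator_vec_exchange:
  assumes "e \<in> B \<times> - B"
  shows "indicator_vec (exchange B e) = indicator_vec B + (axis (snd e) 1 - axis (fst e) 1)"
  using assms by (auto simp: vec_eq_iff indicator_vec_nth exchange_def axis_def)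

lemma card_exchange:
  assumes "e \<in> B \<times> - B"
  shows "card (exchange B (e :: 'a::finite \<times> 'a)) = card B"
proof -
  have "fst e \<in> B" "snd e \<notin> B - {fst e}" using assms by auto
  then show ?thesis using card_Suc_Diff1[of B "fst e"] by (simp add: exchange_def del: card_Diff_insert)
qed

lemma indicator_vec_inner: "indicator_vec A \<bullet> indicator_vec B = real (card (A \<inter> B))"
  by (simp add: inner_indicator_vec indicator_vec_nth Int_commute flip: sum.inter_restrict)

lemma indicator_vec_inner_exchange:
  assumes "e \<in> B \<times> - B"
  shows "indicator_vec B \<bullet> indicator_vec (exchange B e) = real (card B) - 1"
  using assms unfolding indicator_vec_exchange[OF assms]
  by (auto simp: inner_add_right inner_diff_right inner_axis indicator_vec_inner indicator_vec_nth)

lemma weight_inner: "weight p v A = - real_of_ereal (p A) + v \<bullet> indicator_vec A"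
  by (simp add: weight_def inner_indicator_vec)

lemma weight_diff: "weight p u A - weight p v A = (u - v) \<bullet> indicator_vec A"
  by (simp add: weight_inner inner_diff_left)

lemma card_matroid_bases: "A \<in> matroid_bases m p \<Longrightarrow> card A = m"
  by (simp add: matroid_bases_def)

lemma initial_basesD:
  assumes "A \<in> initial_bases m p v"
  shows "A \<in> matroid_bases m p" "A' \<in> matroid_bases m p \<Longrightarrow> weight p v A' \<le> weight p v A"
  using assms by (auto simp: initial_bases_def)

lemma initial_bases_weight_ge:
  assumes "A \<in> initial_bases m p v" "C \<in> matroid_bases m p" "weight p v A \<le> weight p v C"
  shows "C \<in> initial_bases m p v"
  using assms by (force simp: initial_bases_def)

lemma initial_bases_weight_eq:
  assumes "A \<in> initial_bases m p v" "C \<in> initial_bases m p v"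
  shows "weight p v A = weight p v C"
  using assms by (force simp: initial_bases_def)

lemma ereal_matroid_basis:
  assumes "tropical_pluecker m p" "A \<in> matroid_bases m p"
  obtains a where "p A = ereal a"
  using assms by (cases "p A") (auto simp: tropical_pluecker_def matroid_bases_def tropical_def)

section \<open>The valuated exchange property\<close>

text \<open>
  This is the tropical Pluecker relation for $S = A - j$ and $T = C \cup j$. Its \<open>j\<close>-term is
  $p_A + p_C < \infty$, so a term with another index \<open>i\<close> is at most as large. The sums of the
  coordinates of \<open>v\<close> agree on both sides, since $e_A + e_C$ does not change.
\<close>

lemma valuated_exchange:
  assumes P: "tropical_pluecker m p" and A: "A \<in> matroid_bases m p" and C: "C \<in> matroid_bases m p"
    and j: "j \<in> A" "j \<notin> C"
  obtains i where "i \<in> C" "i \<notin> A" "insert i (A - {j}) \<in> matroid_bases m p"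
    "insert j (C - {i}) \<in> matroid_bases m p"
    "weight p v A + weight p v C \<le> weight p v (insert i (A - {j})) + weight p v (insert j (C - {i}))"
proof -
  let ?S = "A - {j}" and ?T = "insert j C"
  let ?f = "\<lambda>i. p (insert i ?S) + p (?T - {i})"
  have cards: "card A = m" "card C = m" using A C by (auto simp: matroid_bases_def)
  have "card ?S + 1 = m" using cards j card_Suc_Diff1[of A j] by simp
  moreover have "card ?T = m + 1" using cards j by simp
  ultimately have tw: "min_twice_or_infinite (?T - ?S) ?f"
    using P unfolding tropical_pluecker_def by blast
  have fj: "?f j = p A + p C" using j by (simp add: insert_absorb)
  have jin: "j \<in> ?T - ?S" by simp
  have le: "(INF i\<in>?T - ?S. ?f i) \<le> p A + p C"
    using INF_lower[OF jin, of ?f] fj by simp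
  have fin: "p A + p C \<noteq> \<infinity>" using A C by (simp add: matroid_bases_def)
  obtain i where i: "i \<in> ?T - ?S" "i \<noteq> j" and fi: "?f i \<le> p A + p C"
  proof -
    have "(INF i\<in>?T - ?S. ?f i) \<noteq> \<infinity>" using le fin by auto
    then obtain a b where "a \<in> ?T - ?S" "b \<in> ?T - ?S" "a \<noteq> b"
      "?f a = (INF i\<in>?T - ?S. ?f i)" "?f b = (INF i\<in>?T - ?S. ?f i)"
      using tw unfolding min_twice_or_infinite_def by blast
    then show ?thesis using that[of a] that[of b] le by (cases "a = j") auto
  qed
  have iC: "i \<in> C" "i \<notin> A" using i by auto
  have T: "?T - {i} = insert j (C - {i})" using i by auto
  have c1: "card (insert i ?S) = m" using \<open>card ?S + 1 = m\<close> iC by simp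
  have c2: "card (insert j (C - {i})) = m" using cards iC j card_Suc_Diff1[of C i] by simp
  have trop: "p (insert i ?S) \<noteq> -\<infinity>" "p (insert j (C - {i})) \<noteq> -\<infinity>"
    using P c1 c2 by (auto simp: tropical_pluecker_def tropical_def)
  have "?f i \<noteq> \<infinity>" using fi fin by auto
  then have b: "insert i ?S \<in> matroid_bases m p" "insert j (C - {i}) \<in> matroid_bases m p"
    using c1 c2 trop T by (auto simp: matroid_bases_def)
  note er = ereal_matroid_basis[OF P]
  have pr: "real_of_ereal (p (insert i ?S)) + real_of_ereal (p (insert j (C - {i})))
      \<le> real_of_ereal (p A) + real_of_ereal (p C)"
    using fi unfolding T
    by - (rule er[OF A], rule er[OF C], rule er[OF b(1)], rule er[OF b(2)], simp)
  have "indicator_vec A + indicator_vec C = indicator_vec (insert i ?S) + indicator_vec (insert j (C - {i}))"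
    using iC j by (auto simp: vec_eq_iff indicator_vec_nth)
  then have "v \<bullet> indicator_vec A + v \<bullet> indicator_vec C
      = v \<bullet> indicator_vec (insert i ?S) + v \<bullet> indicator_vec (insert j (C - {i}))"
    by (metis inner_add_right)
  then have "weight p v A + weight p v C \<le> weight p v (insert i ?S) + weight p v (insert j (C - {i}))"
    using pr by (simp add: weight_inner)
  then show ?thesis using that iC b by blast
qed

text \<open>
  Two heaviest bases cannot be improved, so in \<open>valuated_exchange\<close> both new bases are again
  heaviest: this is symmetric exchange in $M_v$.
\<close>

lemma initial_exchange:
  assumes P: "tropical_pluecker m p" and A: "A \<in> initial_bases m p v" and C: "C \<in> initial_bases m p v"
    and j: "j \<in> A" "j \<notin> C"
  obtains i where "i \<in> C" "i \<notin> A" "insert i (A - {j}) \<in> initial_bases m p v"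
    "insert j (C - {i}) \<in> initial_bases m p v"
proof -
  obtain i where i: "i \<in> C" "i \<notin> A" "insert i (A - {j}) \<in> matroid_bases m p"
    "insert j (C - {i}) \<in> matroid_bases m p"
    "weight p v A + weight p v C \<le> weight p v (insert i (A - {j})) + weight p v (insert j (C - {i}))"
    using valuated_exchange[OF P initial_basesD(1)[OF A] initial_basesD(1)[OF C] j] by metis
  have "weight p v (insert i (A - {j})) \<le> weight p v C" "weight p v (insert j (C - {i})) \<le> weight p v A"
    "weight p v A = weight p v C"
    using initial_basesD(2)[OF C i(3)] initial_basesD(2)[OF A i(4)] initial_bases_weight_eq[OF A C] by auto
  then have "weight p v A \<le> weight p v (insert i (A - {j}))" "weight p v A \<le> weight p v (insert j (C - {i}))"
    using i(5) by auto
  then show ?thesis using that i initial_bases_weight_ge[OF A] by blast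
qed

section \<open>Exchange edges and the local tropical linear space\<close>

text \<open>
  For \<open>v\<close> with \<open>B\<close> a basis of $M_v$ this is the bipartite fundamental graph of $M_v$ at \<open>B\<close>.
  It is defined for all \<open>v\<close>, because faces $\Gamma(M_v)$ that miss the vertex $e_B$ can still
  meet the vertex figure.
\<close>

definition exchange_edges :: "nat \<Rightarrow> ('n::finite set \<Rightarrow> ereal) \<Rightarrow> 'n set \<Rightarrow> real ^ 'n \<Rightarrow> ('n \<times> 'n) set" where
  "exchange_edges m p B v = {e \<in> B \<times> - B. exchange B e \<in> initial_bases m p v}"

lemma exchange_edges_subset: "exchange_edges m p B v \<subseteq> B \<times> - B"
  by (auto simp: exchange_edges_def)

lemma exchange_edgesD:
  assumes "e \<in> exchange_edges m p B v"
  shows "e \<in> B \<times> - B" "exchange B e \<in> initial_bases m p v"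
  using assms by (auto simp: exchange_edges_def)

text \<open>
  The condition on the right says that the matroid $M_v$ has no loop. The circuit of the set
  $B \cup j$ is orthogonal to \<open>v\<close> exactly if some \<open>B - i + j\<close> is as heavy as \<open>B\<close>, which gives
  one direction. Conversely, let the minimum for the circuit of \<open>S\<close> be attained at \<open>k\<close>. Since \<open>k\<close>
  is not a loop, it lies in a basis \<open>C\<close> of $M_v$; exchanging \<open>k\<close> between \<open>C\<close> and \<open>S - k\<close>
  cannot improve on \<open>C\<close>, so it produces a basis \<open>S - i\<close> at least as heavy as \<open>S - k\<close>, and the
  minimum is also attained at \<open>i\<close>.
\<close>

lemma ereal_vec_in_tropical_linear_space_iff:
  assumes P: "tropical_pluecker m p" and B: "B \<in> initial_bases m p v"
  shows "(\<chi> i. ereal (v $ i)) \<in> tropical_linear_space m p \<longleftrightarrow> - B \<subseteq> snd ` exchange_edges m p B v"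
proof
  let ?v = "\<chi> i. ereal (v $ i)"
  have Bb: "B \<in> matroid_bases m p" using initial_basesD[OF B] by simp
  show "- B \<subseteq> snd ` exchange_edges m p B v" if L: "?v \<in> tropical_linear_space m p"
  proof
    fix j assume j: "j \<in> - B"
    let ?S = "insert j B" and ?c = "circuit_vec p (insert j B)"
    have cj: "?c $ j = p B" using j by (simp add: circuit_vec_def insert_Diff_if)
    have "card ?S = m + 1" using j Bb by (simp add: matroid_bases_def)
    moreover have "?c \<noteq> (\<chi> i. \<infinity>)" using cj Bb unfolding vec_eq_iff matroid_bases_def by force
    ultimately have "(\<chi> i. ?c $ i + ereal 0) \<in> circuits m p" unfolding circuits_def by blast
    then have "?c \<in> circuits m p" by (simp flip: zero_ereal_def)
    then have tw: "min_twice_or_infinite UNIV (\<lambda>i. ereal (v $ i) + ?c $ i)"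
      using L by (auto simp: tropical_linear_space_def tropically_orthogonal_def)
    have le: "(INF i. ereal (v $ i) + ?c $ i) \<le> ereal (v $ j) + p B"
      using INF_lower[of j UNIV "\<lambda>i. ereal (v $ i) + ?c $ i"] cj by simp
    have fin: "ereal (v $ j) + p B \<noteq> \<infinity>" using Bb by (simp add: matroid_bases_def)
    obtain i where i: "i \<noteq> j" "ereal (v $ i) + ?c $ i \<le> ereal (v $ j) + p B"
    proof -
      have "(INF i. ereal (v $ i) + ?c $ i) \<noteq> \<infinity>" using le fin by auto
      then obtain a b where "a \<noteq> b"
        "ereal (v $ a) + ?c $ a = (INF i. ereal (v $ i) + ?c $ i)"
        "ereal (v $ b) + ?c $ b = (INF i. ereal (v $ i) + ?c $ i)"
        using tw unfolding min_twice_or_infinite_def by blast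
      then show ?thesis using that[of a] that[of b] le by (cases "a = j") auto
    qed
    have ne: "?c $ i \<noteq> \<infinity>" using i fin by auto
    then have iB: "i \<in> B" using i by (auto simp: circuit_vec_def split: if_splits)
    let ?A = "exchange B (i, j)"
    have e: "(i, j) \<in> B \<times> - B" using iB j by simp
    have ci: "?c $ i = p ?A" using iB i by (simp add: circuit_vec_def exchange_def insert_Diff_if)
    have A: "?A \<in> matroid_bases m p"
      using ne ci Bb card_exchange[OF e] by (simp add: matroid_bases_def)
    have "ereal (v $ i + real_of_ereal (p ?A)) \<le> ereal (v $ j + real_of_ereal (p B))"
      using i(2) unfolding ci
      by - (rule ereal_matroid_basis[OF P A], rule ereal_matroid_basis[OF P Bb], simp)
    then have "weight p v B \<le> weight p v ?A"
      by (simp add: weight_inner indicator_vec_exchange[OF e] inner_add_right inner_diff_right inner_axis)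
    then have "?A \<in> initial_bases m p v" using initial_bases_weight_ge[OF B A] by simp
    then have "(i, j) \<in> exchange_edges m p B v" using e by (simp add: exchange_edges_def)
    then show "j \<in> snd ` exchange_edges m p B v" by force
  qed
  show "?v \<in> tropical_linear_space m p" if cov: "- B \<subseteq> snd ` exchange_edges m p B v"
    unfolding tropical_linear_space_def
  proof (intro CollectI conjI allI ballI)
    show "?v $ i \<in> tropical" for i by (simp add: tropical_def)
    fix c assume "c \<in> circuits m p"
    then obtain S l where S: "card S = m + 1" and c: "c = (\<chi> i. circuit_vec p S $ i + ereal l)"
      by (auto simp: circuits_def)
    let ?f = "\<lambda>i. ?v $ i + c $ i"
    have fin: "finite (range ?f)" "range ?f \<noteq> {}" by auto
    have "(INF i. ?f i) \<in> range ?f" using Min_in[OF fin] unfolding Min_Inf[OF fin] .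
    then obtain k where "(INF i. ?f i) = ?f k" by (rule rangeE)
    note k = this[symmetric]
    show "tropically_orthogonal ?v c"
    proof (cases "?f k = \<infinity>")
      case True
      then show ?thesis using k by (simp add: tropically_orthogonal_def min_twice_or_infinite_def)
    next
      case False
      then have kS: "k \<in> S" and pk: "p (S - {k}) \<noteq> \<infinity>"
        by (auto simp: c circuit_vec_def split: if_splits)
      let ?A = "S - {k}"
      have A: "?A \<in> matroid_bases m p" using S kS pk by (simp add: matroid_bases_def)
      obtain C where C: "C \<in> initial_bases m p v" "k \<in> C"
      proof (cases "k \<in> B")
        case True then show ?thesis using B that by blast
      next
        case False
        then obtain e where "e \<in> exchange_edges m p B v" "snd e = k" using cov by blast
        then show ?thesis using that[of "exchange B e"] by (auto simp: exchange_edges_def exchange_def)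
      qed
      obtain i where i: "i \<in> ?A" "i \<notin> C" "insert i (C - {k}) \<in> matroid_bases m p"
        "insert k (?A - {i}) \<in> matroid_bases m p"
        "weight p v C + weight p v ?A \<le> weight p v (insert i (C - {k})) + weight p v (insert k (?A - {i}))"
        using valuated_exchange[OF P initial_basesD(1)[OF C(1)] A C(2)] by blast
      have Si: "insert k (?A - {i}) = S - {i}" using kS i by auto
      have "weight p v (insert i (C - {k})) \<le> weight p v C" using initial_basesD(2)[OF C(1) i(3)] .
      then have w: "weight p v (S - {k}) \<le> weight p v (S - {i})" using i(5) Si by simp
      have "indicator_vec (S - {k}) = indicator_vec S - axis k 1"
        "indicator_vec (S - {i}) = indicator_vec S - axis i 1"
        using kS i by (auto simp: vec_eq_iff indicator_vec_nth axis_def)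
      then have "v $ i + real_of_ereal (p (S - {i})) \<le> v $ k + real_of_ereal (p (S - {k}))"
        using w by (simp add: weight_inner inner_diff_right inner_axis)
      then have "ereal (v $ i + real_of_ereal (p (S - {i})) + l) \<le> ereal (v $ k + real_of_ereal (p (S - {k})) + l)"
        by simp
      moreover have "?f i = ereal (v $ i + real_of_ereal (p (S - {i})) + l)"
        using i(1) by - (rule ereal_matroid_basis[OF P i(4)], simp add: Si c circuit_vec_def)
      moreover have "?f k = ereal (v $ k + real_of_ereal (p (S - {k})) + l)"
        using kS by - (rule ereal_matroid_basis[OF P A], simp add: c circuit_vec_def)
      ultimately have "?f i \<le> ?f k" by (simp only:)
      then have "?f i \<le> (INF i. ?f i)" unfolding k .
      then have "?f i = (INF i. ?f i)" by (intro antisym INF_lower) auto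
      then show ?thesis using k i(1) unfolding tropically_orthogonal_def min_twice_or_infinite_def
        by blast
    qed
  qed
qed

section \<open>The exchange edges determine the initial matroid\<close>

lemma sum_scaleR_point_mass:
  fixes f :: "'i \<Rightarrow> 'a::real_vector"
  assumes "finite I" "i \<in> I"
  shows "(\<Sum>k\<in>I. (if k = i then 1 else 0) *\<^sub>R f k) = f i"
  using assms by (simp add: if_distrib[of "\<lambda>x. x *\<^sub>R _"] cong: if_cong)

text \<open>
  The cone of $\Gamma(M_v)$ at its vertex $e_B$ is spanned by the edge directions $e_j - e_i$.
  A symmetric exchange of $j \in A \setminus B$ replaces \<open>A\<close> by $A - j + i$, which is closer to
  \<open>B\<close>, and shows at the same time that $(i, j)$ is an exchange edge.
\<close>

lemma indicator_vec_initial_basis_in_exchange_cone: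
  assumes P: "tropical_pluecker m p" and B: "B \<in> initial_bases m p v"
    and A: "A \<in> initial_bases m p v"
  shows "\<exists>c. (\<forall>e\<in>exchange_edges m p B v. 0 \<le> c e) \<and>
    indicator_vec A = indicator_vec B +
      (\<Sum>e\<in>exchange_edges m p B v. c e *\<^sub>R (axis (snd e) 1 - axis (fst e) 1))"
  using A
proof (induction "card (A - B)" arbitrary: A)
  case 0
  then have "A \<subseteq> B" by auto
  moreover have "card A = card B"
    using 0 B by (auto simp: initial_bases_def matroid_bases_def)
  ultimately have "A = B" by (simp add: card_subset_eq)
  then show ?case by (intro exI[of _ "\<lambda>_. 0"]) simp
next
  case (Suc k)
  then obtain j where j: "j \<in> A" "j \<notin> B"
    by (metis Diff_iff card.empty ex_in_conv nat.simps(3))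
  obtain i where i: "i \<in> B" "i \<notin> A" "insert i (A - {j}) \<in> initial_bases m p v"
    "insert j (B - {i}) \<in> initial_bases m p v"
    using initial_exchange[OF P Suc.prems B j] by blast
  let ?A = "insert i (A - {j})" and ?E = "exchange_edges m p B v"
  let ?D = "\<lambda>e. axis (snd e) 1 - axis (fst e) 1 :: real ^ 'a"
  have "A - B = insert j (?A - B)" using i j by auto
  moreover have "j \<notin> ?A - B" using i j by auto
  ultimately have "k = card (?A - B)" using Suc(2) by simp
  then obtain c where c: "\<forall>e\<in>?E. 0 \<le> c e"
    "indicator_vec ?A = indicator_vec B + (\<Sum>e\<in>?E. c e *\<^sub>R ?D e)"
    using Suc.hyps(1)[OF _ i(3)] by blast
  have e: "(i, j) \<in> ?E" using i j by (simp add: exchange_edges_def exchange_def)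
  have "indicator_vec A = indicator_vec ?A + ?D (i, j)"
    using i j by (auto simp: vec_eq_iff indicator_vec_nth axis_def)
  also have "\<dots> = indicator_vec B + (\<Sum>e\<in>?E. (c e + (if e = (i, j) then 1 else 0)) *\<^sub>R ?D e)"
    using sum_scaleR_point_mass[OF finite e, of ?D] c(2) by (simp add: scaleR_add_left sum.distrib)
  finally show ?case using c(1) by (intro exI[of _ "\<lambda>e. c e + (if e = (i, j) then 1 else 0)"]) auto
qed

text \<open>
  When \<open>v\<close> moves to \<open>u\<close>, the deficit of \<open>B - i + j\<close> relative to \<open>B\<close> changes by a linear function
  of the edge. This is what lets the deficits act as a height function common to all \<open>v\<close>.
\<close>

lemma inner_exchange:
  assumes "e \<in> B \<times> - B"
  shows "(u - v) \<bullet> (axis (snd e) 1 - axis (fst e) 1)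
    = (weight p v B - weight p v (exchange B e)) - (weight p u B - weight p u (exchange B e))"
proof -
  have "(u - v) \<bullet> (axis (snd e) 1 - axis (fst e) 1)
      = (u - v) \<bullet> indicator_vec (exchange B e) - (u - v) \<bullet> indicator_vec B"
    by (simp add: indicator_vec_exchange[OF assms] inner_add_right)
  then show ?thesis unfolding weight_diff[of p, symmetric] by simp
qed

text \<open>
  For $A$ a basis of $M_v$ the vector $e_A - e_B$ is a combination of the edge directions of $M_v$.
  If these edges are also edges of $M_u$, then $u - v$ is orthogonal to each of them, so
  $A$ and \<open>B\<close> have equal weight for \<open>u\<close> as well.
\<close>

lemma initial_bases_subset_iff:
  assumes P: "tropical_pluecker m p" and u: "B \<in> initial_bases m p u" and v: "B \<in> initial_bases m p v"
  shows "initial_bases m p v \<subseteq> initial_bases m p u \<longleftrightarrow> exchange_edges m p B v \<subseteq> exchange_edges m p B u"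
proof
  assume "initial_bases m p v \<subseteq> initial_bases m p u"
  then show "exchange_edges m p B v \<subseteq> exchange_edges m p B u" by (auto simp: exchange_edges_def)
next
  assume sub: "exchange_edges m p B v \<subseteq> exchange_edges m p B u"
  show "initial_bases m p v \<subseteq> initial_bases m p u"
  proof
    fix A assume A: "A \<in> initial_bases m p v"
    let ?E = "exchange_edges m p B v"
    let ?D = "\<lambda>e. axis (snd e) 1 - axis (fst e) 1 :: real ^ 'a"
    obtain c where c: "indicator_vec A = indicator_vec B + (\<Sum>e\<in>?E. c e *\<^sub>R ?D e)"
      using indicator_vec_initial_basis_in_exchange_cone[OF P v A] by blast
    have z: "(u - v) \<bullet> ?D e = 0" if e: "e \<in> ?E" for e
      using inner_exchange[OF exchange_edgesD(1)[OF e], of u v p]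
        initial_bases_weight_eq[OF v exchange_edgesD(2)[OF e]]
        initial_bases_weight_eq[OF u exchange_edgesD(2)[OF subsetD[OF sub e]]] by simp
    have "(u - v) \<bullet> indicator_vec A = (u - v) \<bullet> indicator_vec B"
      using z by (simp add: c inner_add_right inner_sum_right)
    then have "weight p u A - weight p v A = weight p u B - weight p v B"
      by (simp add: weight_diff)
    then have "weight p u B \<le> weight p u A" using initial_bases_weight_eq[OF v A] by simp
    then show "A \<in> initial_bases m p u"
      using initial_bases_weight_ge[OF u initial_basesD(1)[OF A]] by simp
  qed
qed

section \<open>Cells of the mixed subdivision and their labels\<close>

text \<open>
  For $E \subseteq B \times ([n] \setminus B)$ this is the Minkowski sum
  $\sum_{j \notin B} \Delta_{E(j)}$ with $E(j) = \{i : (i,j) \in E\}$: the second equation says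
  that for each $j \notin B$ the weights of the edges at \<open>j\<close> add up to 1, so that the first
  equation makes \<open>y\<close> a sum of one point from each simplex. Keeping both equations in the same
  shape matches the Cayley embedding, where an edge stands for the vertex $e_i + e_j$.
\<close>

definition mixed_cell :: "'n::finite set \<Rightarrow> ('n \<times> 'n) set \<Rightarrow> (real ^ 'n) set" where
  "mixed_cell B E = {y. \<exists>c. (\<forall>e\<in>E. 0 \<le> c e) \<and>
     (\<Sum>e\<in>E. c e *\<^sub>R axis (fst e) 1) = y \<and>
     (\<Sum>e\<in>E. c e *\<^sub>R axis (snd e) 1) = indicator_vec (- B)}"

text \<open>
  Each $j \notin B$ distributes the weight 1 evenly among its edges. All weights are positive, so the
  point of the cell that they define lies in its relative interior.
\<close>

lemma covering_edges_positive_weights: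
  fixes E :: "('n::finite \<times> 'n) set"
  assumes E: "E \<subseteq> B \<times> - B" and cov: "- B \<subseteq> snd ` E"
  obtains c where "\<forall>e\<in>E. 0 < c e"
    "(\<Sum>e\<in>E. c e *\<^sub>R axis (snd e) (1::real)) = indicator_vec (- B)"
proof -
  let ?d = "\<lambda>j. real (card {e \<in> E. snd e = j})"
  have d: "0 < ?d j" if "j \<in> snd ` E" for j
    using that by (auto simp: card_gt_0_iff)
  have "(\<Sum>e\<in>E. (1 / ?d (snd e)) *\<^sub>R axis (snd e) (1::real)) $ j = indicator_vec (- B) $ j" for j
  proof -
    \<comment> \<open>Only edges at \<open>j\<close> contribute, each with the same weight.\<close>
    have "(\<Sum>e\<in>E. (1 / ?d (snd e)) *\<^sub>R axis (snd e) (1::real)) $ j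
      = (\<Sum>e\<in>E. if snd e = j then 1 / ?d j else 0)"
      by (auto simp: axis_def intro!: sum.cong)
    also have "\<dots> = ?d j * (1 / ?d j)"
      by (simp flip: sum.inter_filter)
    also have "\<dots> = (if j \<in> snd ` E then 1 else 0)"
    proof (cases "j \<in> snd ` E")
      case True
      then show ?thesis unfolding if_P[OF True] using True d[OF True] by auto
    next
      case False
      then have "{e \<in> E. snd e = j} = {}" by (auto simp: image_iff)
      then have "?d j = 0" by (simp only: card.empty of_nat_0)
      then show ?thesis using False by simp
    qed
    also have "\<dots> = indicator_vec (- B) $ j"
      using E cov by (auto simp: indicator_vec_nth)
    finally show ?thesis .
  qed
  then show ?thesis using d that[of "\<lambda>e. 1 / ?d (snd e)"] by (simp add: vec_eq_iff)
qed

lemma mixed_cell_nonempty_iff: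
  assumes E: "E \<subseteq> B \<times> - B"
  shows "mixed_cell B E \<noteq> {} \<longleftrightarrow> - B \<subseteq> snd ` E"
proof
  assume "mixed_cell B E \<noteq> {}"
  then obtain c where c: "(\<Sum>e\<in>E. c e *\<^sub>R axis (snd e) (1::real)) = indicator_vec (- B)"
    by (auto simp: mixed_cell_def)
  show "- B \<subseteq> snd ` E"
  proof (rule ccontr)
    assume "\<not> - B \<subseteq> snd ` E"
    then obtain j where j: "j \<in> - B" "j \<notin> snd ` E" by blast
    have "(\<Sum>e\<in>E. c e *\<^sub>R axis (snd e) (1::real)) $ j = 0"
      using j(2) by (auto simp: axis_def image_iff intro!: sum.neutral)
    then show False using j by (simp add: c indicator_vec_nth)
  qed
next
  assume "- B \<subseteq> snd ` E"
  then obtain c where c: "\<forall>e\<in>E. 0 < c e"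
    "(\<Sum>e\<in>E. c e *\<^sub>R axis (snd e) (1::real)) = indicator_vec (- B)"
    using covering_edges_positive_weights[OF E] by blast
  then have "(\<Sum>e\<in>E. c e *\<^sub>R axis (fst e) 1) \<in> mixed_cell B E"
    unfolding mixed_cell_def by (intro CollectI exI[of _ c]) (auto intro: less_imp_le)
  then show "mixed_cell B E \<noteq> {}" by blast
qed

lemma mixed_cell_mono:
  assumes "E \<subseteq> F"
  shows "mixed_cell B E \<subseteq> mixed_cell B F"
proof
  fix y assume "y \<in> mixed_cell B E"
  then obtain c where c: "\<forall>e\<in>E. 0 \<le> c e" "(\<Sum>e\<in>E. c e *\<^sub>R axis (fst e) 1) = y"
     "(\<Sum>e\<in>E. c e *\<^sub>R axis (snd e) 1) = indicator_vec (- B)" by (auto simp: mixed_cell_def)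
  let ?c = "\<lambda>e. if e \<in> E then c e else 0"
  have "(\<Sum>e\<in>F. ?c e *\<^sub>R h e) = (\<Sum>e\<in>E. c e *\<^sub>R h e)" for h :: "'a \<times> 'a \<Rightarrow> real ^ 'a"
    using assms by (intro sum.mono_neutral_cong_right) auto
  then show "y \<in> mixed_cell B F" using c unfolding mixed_cell_def
    by (intro CollectI exI[of _ ?c]) auto
qed

text \<open>
  The cell of an arbitrary set of edges does not determine that set, but for cells from a common
  height function the labels can be recovered. Let $s_w(e) \ge 0$ be the deficit of the
  exchange \<open>e\<close>, which vanishes exactly on the exchange edges of \<open>w\<close>. If a point \<open>y\<close> is written
  with weights \<open>a\<close>, then $\sum_e a_e (s_v(e) - s_u(e)) = (u - v) \cdot (e_{[n] \setminus B} - y)$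
  depends on \<open>y\<close> only. Weights supported on the edges of \<open>u\<close> show that this number is nonnegative,
  weights supported on the edges of \<open>v\<close> that it is nonpositive. So it is 0, and $s_u$ vanishes
  wherever the weights on the edges of \<open>v\<close> are positive; for a relative interior point that is
  on all of them.
\<close>

lemma mixed_cell_subset_iff:
  assumes u: "B \<in> initial_bases m p u" and v: "B \<in> initial_bases m p v"
    and cov: "- B \<subseteq> snd ` exchange_edges m p B v"
  shows "mixed_cell B (exchange_edges m p B v) \<subseteq> mixed_cell B (exchange_edges m p B u)
    \<longleftrightarrow> exchange_edges m p B v \<subseteq> exchange_edges m p B u"
proof
  let ?E = "exchange_edges m p B"
  let ?s = "\<lambda>w e. weight p w B - weight p w (exchange B e)"
  let ?D = "\<lambda>e. axis (snd e) 1 - axis (fst e) 1 :: real ^ 'a"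
  assume sub: "mixed_cell B (?E v) \<subseteq> mixed_cell B (?E u)"
  obtain c where c: "\<forall>e\<in>?E v. 0 < c e" "(\<Sum>e\<in>?E v. c e *\<^sub>R axis (snd e) 1) = indicator_vec (- B)"
    using covering_edges_positive_weights[OF exchange_edges_subset cov] by blast
  define y where "y = (\<Sum>e\<in>?E v. c e *\<^sub>R axis (fst e) (1::real))"
  have "y \<in> mixed_cell B (?E v)" using c unfolding mixed_cell_def y_def
    by (intro CollectI exI[of _ c]) (auto intro: less_imp_le)
  then have "y \<in> mixed_cell B (?E u)" using sub by blast
  then obtain d where d: "\<forall>e\<in>?E u. 0 \<le> d e" "(\<Sum>e\<in>?E u. d e *\<^sub>R axis (fst e) 1) = y"
     "(\<Sum>e\<in>?E u. d e *\<^sub>R axis (snd e) 1) = indicator_vec (- B)"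
    unfolding mixed_cell_def by blast
  have s0: "0 \<le> ?s w e" if "B \<in> initial_bases m p w" "e \<in> ?E w'" for w w' e
    using initial_basesD(2)[OF that(1) initial_basesD(1)[OF exchange_edgesD(2)[OF that(2)]]] by simp
  have s1: "?s w e = 0" if "B \<in> initial_bases m p w" "e \<in> ?E w" for w e
    using initial_bases_weight_eq[OF that(1) exchange_edgesD(2)[OF that(2)]] by simp
  have k: "(u - v) \<bullet> (indicator_vec (- B) - y) = (\<Sum>e\<in>?E w. a e * (?s v e - ?s u e))"
    if "(\<Sum>e\<in>?E w. a e *\<^sub>R axis (fst e) 1) = y" "(\<Sum>e\<in>?E w. a e *\<^sub>R axis (snd e) 1) = indicator_vec (- B)"
    for a w
  proof -
    have "(u - v) \<bullet> (indicator_vec (- B) - y) = (\<Sum>e\<in>?E w. a e * ((u - v) \<bullet> ?D e))"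
      unfolding that[symmetric]
      by (simp only: inner_diff_right inner_sum_right inner_scaleR_right right_diff_distrib sum_subtractf)
    also have "\<dots> = (\<Sum>e\<in>?E w. a e * (?s v e - ?s u e))"
      by (intro sum.cong refl arg_cong2[where f = "(*)"] inner_exchange[OF exchange_edgesD(1)])
    finally show ?thesis .
  qed
  have "(u - v) \<bullet> (indicator_vec (- B) - y) = (\<Sum>e\<in>?E u. d e * ?s v e)"
    using k[OF d(2,3)] s1[OF u] by simp
  then have ge: "0 \<le> (u - v) \<bullet> (indicator_vec (- B) - y)"
    using d(1) s0[OF v] by (simp add: sum_nonneg)
  have "(u - v) \<bullet> (indicator_vec (- B) - y) = - (\<Sum>e\<in>?E v. c e * ?s u e)"
    using k[OF y_def[symmetric] c(2)] s1[OF v] by (simp add: right_diff_distrib sum_subtractf)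
  moreover have nn: "0 \<le> c e * ?s u e" if "e \<in> ?E v" for e
    using c(1) that s0[OF u that] by (intro mult_nonneg_nonneg) (auto intro: less_imp_le)
  ultimately have "(\<Sum>e\<in>?E v. c e * ?s u e) = 0" using ge sum_nonneg[of "?E v" "\<lambda>e. c e * ?s u e"] by force
  then have z: "c e * ?s u e = 0" if "e \<in> ?E v" for e
    using nn that by (subst (asm) sum_nonneg_eq_0_iff) auto
  show "?E v \<subseteq> ?E u"
  proof
    fix e assume e: "e \<in> ?E v"
    then have "?s u e = 0" using z[OF e] c(1) by auto
    then show "e \<in> ?E u"
      using initial_bases_weight_ge[OF u initial_basesD(1)[OF exchange_edgesD(2)[OF e]]]
        exchange_edgesD(1)[OF e] by (simp add: exchange_edges_def)
  qed
qed (rule mixed_cell_mono)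

section \<open>Faces of the local subdivision\<close>

lemma hyperplane_eq_inner: "{x. (\<Sum>i\<in>B. x $ i) = b} = {x. indicator_vec B \<bullet> x = b}"
  by (simp add: inner_indicator_vec inner_commute[of "indicator_vec B"])

lemma convex_hull_image_eq:
  fixes f :: "'i \<Rightarrow> 'a::real_vector"
  assumes "finite I"
  shows "convex hull (f ` I) = {x. \<exists>c. (\<forall>i\<in>I. 0 \<le> c i) \<and> sum c I = 1 \<and> (\<Sum>i\<in>I. c i *\<^sub>R f i) = x}"
    (is "_ = ?R")
proof
  show "convex hull (f ` I) \<subseteq> ?R"
  proof (rule hull_minimal)
    show "f ` I \<subseteq> ?R"
    proof (clarify)
      fix i assume i: "i \<in> I"
      have "(\<Sum>k\<in>I. (if k = i then 1 else 0) *\<^sub>R f k) = f i"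
        using assms i by (rule sum_scaleR_point_mass)
      moreover have "(\<Sum>k\<in>I. (if k = i then 1 else 0)) = (1::real)" using i assms by simp
      ultimately show "\<exists>c. (\<forall>i\<in>I. 0 \<le> c i) \<and> sum c I = 1 \<and> (\<Sum>i\<in>I. c i *\<^sub>R f i) = f i"
        by (intro exI[of _ "\<lambda>k. if k = i then 1 else 0"]) auto
    qed
    show "convex ?R"
    proof (rule convexI, clarify)
      fix c d :: "'i \<Rightarrow> real" and s t :: real
      assume a: "0 \<le> s" "0 \<le> t" "s + t = 1" "\<forall>i\<in>I. 0 \<le> c i" "sum c I = 1" "\<forall>i\<in>I. 0 \<le> d i" "sum d I = 1"
      let ?c = "\<lambda>i. s * c i + t * d i"
      have "sum ?c I = 1" using a by (simp add: sum.distrib flip: sum_distrib_left)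
      moreover have "(\<Sum>i\<in>I. ?c i *\<^sub>R f i) = s *\<^sub>R (\<Sum>i\<in>I. c i *\<^sub>R f i) + t *\<^sub>R (\<Sum>i\<in>I. d i *\<^sub>R f i)"
        by (simp add: scaleR_add_left sum.distrib scaleR_sum_right)
      ultimately show "\<exists>e. (\<forall>i\<in>I. 0 \<le> e i) \<and> sum e I = 1 \<and> (\<Sum>i\<in>I. e i *\<^sub>R f i) =
          s *\<^sub>R (\<Sum>i\<in>I. c i *\<^sub>R f i) + t *\<^sub>R (\<Sum>i\<in>I. d i *\<^sub>R f i)"
        using a by (intro exI[of _ ?c]) auto
    qed
  qed
  show "?R \<subseteq> convex hull (f ` I)"
    using assms by (auto intro!: convex_sum intro: hull_inc)
qed

text \<open>
  By the cone description, $x = e_B + \sum_e c_e (e_j - e_i)$ with $c \ge 0$. Every edge direction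
  lowers the \<open>B\<close>-coordinate sum by 1, so on the hyperplane the weights \<open>c\<close> add up to 1 and turn
  the conic combination into a convex combination of the vectors $e_{B - i + j}$.
\<close>

lemma matroid_polytope_Int_vertex_figure_basis:
  assumes P: "tropical_pluecker m p" and B: "B \<in> initial_bases m p v"
    and x: "x \<in> matroid_polytope (initial_bases m p v)" and s: "indicator_vec B \<bullet> x = real m - 1"
  shows "x \<in> convex hull ((\<lambda>e. indicator_vec (exchange B e)) ` exchange_edges m p B v)"
proof -
  let ?E = "exchange_edges m p B v"
  let ?D = "\<lambda>e. axis (snd e) 1 - axis (fst e) 1 :: real ^ 'a"
  let ?K = "{x. \<exists>c. (\<forall>e\<in>?E. 0 \<le> c e) \<and> x = indicator_vec B + (\<Sum>e\<in>?E. c e *\<^sub>R ?D e)}"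
  have "matroid_polytope (initial_bases m p v) \<subseteq> ?K"
    unfolding matroid_polytope_def
  proof (rule hull_minimal)
    show "indicator_vec ` initial_bases m p v \<subseteq> ?K"
      using indicator_vec_initial_basis_in_exchange_cone[OF P B] by blast
    show "convex ?K"
    proof (rule convexI, clarify)
      fix c d :: "'a \<times> 'a \<Rightarrow> real" and s t :: real
      assume a: "0 \<le> s" "0 \<le> t" "s + t = 1" "\<forall>i\<in>?E. 0 \<le> c i" "\<forall>i\<in>?E. 0 \<le> d i"
      let ?c = "\<lambda>i. s * c i + t * d i"
      have "s *\<^sub>R (indicator_vec B + (\<Sum>i\<in>?E. c i *\<^sub>R ?D i)) + t *\<^sub>R (indicator_vec B + (\<Sum>i\<in>?E. d i *\<^sub>R ?D i))
          = (s + t) *\<^sub>R indicator_vec B + (\<Sum>e\<in>?E. ?c e *\<^sub>R ?D e)"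
        unfolding scaleR_add_left scaleR_add_right sum.distrib scaleR_sum_right by simp
      then show "\<exists>e. (\<forall>i\<in>?E. 0 \<le> e i) \<and>
          s *\<^sub>R (indicator_vec B + (\<Sum>i\<in>?E. c i *\<^sub>R ?D i)) + t *\<^sub>R (indicator_vec B + (\<Sum>i\<in>?E. d i *\<^sub>R ?D i))
          = indicator_vec B + (\<Sum>i\<in>?E. e i *\<^sub>R ?D i)"
        using a by (intro exI[of _ ?c]) auto
    qed
  qed
  then obtain c where c: "\<forall>e\<in>?E. 0 \<le> c e" "x = indicator_vec B + (\<Sum>e\<in>?E. c e *\<^sub>R ?D e)"
    using x by blast
  have m: "card B = m" using B by (simp add: initial_bases_def matroid_bases_def)
  have D: "indicator_vec B \<bullet> ?D e = - 1" if "e \<in> ?E" for e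
    using exchange_edgesD(1)[OF that] by (auto simp: inner_diff_right inner_axis indicator_vec_nth)
  have "indicator_vec B \<bullet> x = real m + (\<Sum>e\<in>?E. c e * (indicator_vec B \<bullet> ?D e))"
    by (simp add: c(2) m inner_add_right inner_sum_right indicator_vec_inner)
  then have sum1: "sum c ?E = 1" using s D by (simp add: sum_negf)
  have "(\<Sum>e\<in>?E. c e *\<^sub>R indicator_vec (exchange B e)) = (\<Sum>e\<in>?E. c e *\<^sub>R indicator_vec B + c e *\<^sub>R ?D e)"
    by (intro sum.cong refl) (simp only: indicator_vec_exchange[OF exchange_edgesD(1)] scaleR_add_right)
  also have "\<dots> = x" by (simp add: c(2) sum.distrib sum1 flip: scaleR_sum_left)
  finally show ?thesis using c(1) sum1 unfolding convex_hull_image_eq[OF finite] by blast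
qed

text \<open>
  If \<open>B\<close> is not among the bases of $M_v$, each of them meets \<open>B\<close> in at most $m - 1$ elements. The
  hyperplane then supports $\Gamma(M_v)$, and cuts out the face spanned by the vertices on it.
\<close>

lemma matroid_polytope_Int_vertex_figure_nonbasis:
  assumes B: "B \<in> matroid_bases m p" and nB: "B \<notin> initial_bases m p v"
    and x: "x \<in> matroid_polytope (initial_bases m p v)" and s: "indicator_vec B \<bullet> x = real m - 1"
  shows "x \<in> convex hull ((\<lambda>e. indicator_vec (exchange B e)) ` exchange_edges m p B v)"
proof -
  let ?N = "initial_bases m p v" and ?H = "{x. indicator_vec B \<bullet> x = real m - 1}"
  let ?f = "\<lambda>e. indicator_vec (exchange B e)"
  have m: "card B = m" using B by (rule card_matroid_bases)
  have cN: "card A = m" if "A \<in> ?N" for A using that by (simp add: initial_bases_def matroid_bases_def)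
  have le: "indicator_vec B \<bullet> indicator_vec A \<le> real m - 1" if A: "A \<in> ?N" for A
  proof -
    have "\<not> B \<subseteq> A" using card_subset_eq[of A B] cN[OF A] m A nB by auto
    then have "card (B \<inter> A) < card B" by (intro psubset_card_mono) auto
    then show ?thesis using m by (simp add: indicator_vec_inner)
  qed
  have "matroid_polytope ?N \<inter> ?H face_of matroid_polytope ?N"
  proof (rule face_of_Int_supporting_hyperplane_le)
    show "convex (matroid_polytope ?N)" by (simp add: matroid_polytope_def)
    have "matroid_polytope ?N \<subseteq> {x. indicator_vec B \<bullet> x \<le> real m - 1}"
      unfolding matroid_polytope_def by (rule hull_minimal) (use le convex_halfspace_le in auto)
    then show "indicator_vec B \<bullet> x \<le> real m - 1" if "x \<in> matroid_polytope ?N" for x using that by blast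
  qed
  \<comment> \<open>A face of the hull of a finite set is the hull of a subset \<open>T\<close>, whose members lie on the hyperplane.\<close>
  then obtain T where T: "T \<subseteq> indicator_vec ` ?N" "matroid_polytope ?N \<inter> ?H = convex hull T"
    unfolding matroid_polytope_def
    by (rule face_of_convex_hull_subset[rotated]) (auto intro: finite_imp_compact)
  have "T \<subseteq> ?f ` exchange_edges m p B v"
  proof
    fix t assume t: "t \<in> T"
    then obtain A where A: "A \<in> ?N" "t = indicator_vec A" using T by blast
    have "t \<in> ?H" using t T(2) hull_inc[of t T convex] by blast
    then have c: "card (B \<inter> A) + 1 = m" by (simp add: A indicator_vec_inner)
    have "card (A - B) = 1" using c cN[OF A(1)] card_Int_Diff[of A B] by (simp add: Int_commute)
    then obtain j where j: "A - B = {j}" by (auto simp: card_1_singleton_iff)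
    have "card (B - A) = 1" using c m card_Int_Diff[of B A] by simp
    then obtain i where i: "B - A = {i}" by (auto simp: card_1_singleton_iff)
    have "A = exchange B (i, j)" using i j by (auto simp: exchange_def)
    moreover have "(i, j) \<in> B \<times> - B" using i j by auto
    ultimately show "t \<in> ?f ` exchange_edges m p B v" using A by (auto simp: exchange_edges_def)
  qed
  then have "convex hull T \<subseteq> convex hull (?f ` exchange_edges m p B v)" by (rule hull_mono)
  then show ?thesis using x s T(2) by blast
qed

lemma matroid_polytope_Int_vertex_figure:
  assumes P: "tropical_pluecker m p" and B: "B \<in> matroid_bases m p"
  shows "matroid_polytope (initial_bases m p v) \<inter> vertex_figure m p B =
    convex hull ((\<lambda>e. indicator_vec (exchange B e)) ` exchange_edges m p B v)" (is "?L = ?R")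
proof
  show "?L \<subseteq> ?R"
    using matroid_polytope_Int_vertex_figure_basis[OF P] matroid_polytope_Int_vertex_figure_nonbasis[OF B]
    unfolding vertex_figure_def hyperplane_eq_inner by blast
  have "?R \<subseteq> matroid_polytope (initial_bases m p v)"
    unfolding matroid_polytope_def by (intro hull_mono) (auto simp: exchange_edges_def)
  moreover have "matroid_polytope (initial_bases m p v) \<subseteq> matroid_polytope (matroid_bases m p)"
    unfolding matroid_polytope_def by (intro hull_mono) (auto simp: initial_bases_def)
  moreover have "?R \<subseteq> {x. indicator_vec B \<bullet> x = real m - 1}"
    by (rule hull_minimal) (use card_matroid_bases[OF B] convex_hyperplane
      indicator_vec_inner_exchange[OF exchange_edgesD(1)] in auto)
  ultimately show "?R \<subseteq> ?L" unfolding vertex_figure_def hyperplane_eq_inner by blast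
qed

section \<open>The Cayley trick\<close>

lemma cayley_map_exchange:
  assumes "e \<in> B \<times> - B"
  shows "cayley_map B (indicator_vec (exchange B e)) = axis (fst e) 1 + axis (snd e) 1"
  using assms by (auto simp: cayley_map_def vec_eq_iff indicator_vec_nth exchange_def axis_def)

lemma cayley_map_affine_sum:
  assumes "sum c I = 1"
  shows "cayley_map B (\<Sum>i\<in>I. c i *\<^sub>R f i) = (\<Sum>i\<in>I. c i *\<^sub>R cayley_map B (f i))"
  using assms by (auto simp: cayley_map_def vec_eq_iff right_diff_distrib sum_subtractf)

text \<open>
  A point of the Cayley polytope is $\sum_e c_e (e_i + e_j)$. Its coordinates in \<open>B\<close> and outside
  \<open>B\<close> separate the two sums, and after scaling by $k = n - m$ they become the two equations
  that define a mixed cell. That the weights of a point of the mixed cell add up to \<open>k\<close> is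
  forced by the second equation.
\<close>

lemma cayley_slice_eq_mixed_cell:
  fixes B :: "'n::finite set"
  assumes E: "E \<subseteq> B \<times> - B" and B: "B \<noteq> UNIV" and k: "k = real (card (- B))"
  shows "{y. (\<forall>j. j \<notin> B \<longrightarrow> y $ j = 0) \<and> (1 / k) *\<^sub>R (y + indicator_vec (- B))
      \<in> cayley_map B ` (convex hull ((\<lambda>e. indicator_vec (exchange B e)) ` E))} = mixed_cell B E"
    (is "?S = _")
proof
  let ?f = "\<lambda>e. indicator_vec (exchange B e)"
  let ?a = "\<lambda>c. \<Sum>e\<in>E. c e *\<^sub>R axis (fst e) (1::real)"
  let ?b = "\<lambda>c. \<Sum>e\<in>E. c e *\<^sub>R axis (snd e) (1::real)"
  have "- B \<noteq> {}" using B by blast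
  then have k0: "0 < k" by (simp add: k card_gt_0_iff)
  have a0: "?a c $ i = 0" if "i \<notin> B" for c i
    using E that by (auto simp: axis_def intro!: sum.neutral)
  have b0: "?b c $ i = 0" if "i \<in> B" for c i
    using E that by (auto simp: axis_def intro!: sum.neutral)
  have cay: "cayley_map B (\<Sum>e\<in>E. c e *\<^sub>R ?f e) = ?a c + ?b c" if "sum c E = 1" for c
  proof -
    have "cayley_map B (\<Sum>e\<in>E. c e *\<^sub>R ?f e) = (\<Sum>e\<in>E. c e *\<^sub>R (axis (fst e) 1 + axis (snd e) 1))"
      unfolding cayley_map_affine_sum[OF that] using E by (intro sum.cong) (auto simp: cayley_map_exchange)
    then show ?thesis by (simp add: scaleR_add_right sum.distrib)
  qed
  show "?S \<subseteq> mixed_cell B E"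
  proof (clarify, unfold convex_hull_image_eq[OF finite], clarify)
    fix y :: "real ^ 'n" and c
    assume y: "\<forall>j. j \<notin> B \<longrightarrow> y $ j = 0" and c: "\<forall>e\<in>E. 0 \<le> c e" "sum c E = 1"
      and eq: "(1 / k) *\<^sub>R (y + indicator_vec (- B)) = cayley_map B (\<Sum>e\<in>E. c e *\<^sub>R ?f e)"
    let ?c = "\<lambda>e. k * c e"
    have "y + indicator_vec (- B) = k *\<^sub>R ((1 / k) *\<^sub>R (y + indicator_vec (- B)))" using k0 by simp
    also have "\<dots> = ?a ?c + ?b ?c"
      unfolding eq cay[OF c(2)] by (simp add: scaleR_add_right scaleR_sum_right)
    finally have eq': "y + indicator_vec (- B) = ?a ?c + ?b ?c" .
    have s: "y $ i + indicator_vec (- B) $ i = ?a ?c $ i + ?b ?c $ i" for i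
      using arg_cong[OF eq', of "\<lambda>x. x $ i"] by (simp only: vector_add_component)
    have "?a ?c $ i = y $ i \<and> ?b ?c $ i = indicator_vec (- B) $ i" for i
      using s[of i] a0[of i ?c] b0[of i ?c] y by (cases "i \<in> B") (auto simp: indicator_vec_nth)
    then have "?a ?c = y" "?b ?c = indicator_vec (- B)" by (auto simp only: vec_eq_iff)
    then show "y \<in> mixed_cell B E"
      unfolding mixed_cell_def using c(1) k0 by (intro CollectI exI[of _ ?c]) auto
  qed
  show "mixed_cell B E \<subseteq> ?S"
  proof
    fix y assume "y \<in> mixed_cell B E"
    then obtain c where c: "\<forall>e\<in>E. 0 \<le> c e" "?a c = y" "?b c = indicator_vec (- B)"
      unfolding mixed_cell_def by blast
    let ?c = "\<lambda>e. c e / k"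
    have "k = indicator_vec (- B) \<bullet> ?b c" by (simp add: c(3) k indicator_vec_inner)
    also have "\<dots> = (\<Sum>e\<in>E. c e * (indicator_vec (- B) \<bullet> axis (snd e) 1))"
      by (simp add: inner_sum_right)
    also have "\<dots> = sum c E"
      using E by (intro sum.cong) (auto simp: inner_axis indicator_vec_nth)
    finally have "sum ?c E = 1" using k0 by (simp flip: sum_divide_distrib)
    have "(1 / k) *\<^sub>R (y + indicator_vec (- B)) = ?a ?c + ?b ?c"
      by (simp add: c(3) scaleR_add_right scaleR_sum_right flip: c(2) c(3))
    also have "\<dots> = cayley_map B (\<Sum>e\<in>E. ?c e *\<^sub>R ?f e)" using cay \<open>sum ?c E = 1\<close> by simp
    also have "\<dots> \<in> cayley_map B ` (convex hull (?f ` E))"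
      unfolding convex_hull_image_eq[OF finite] using c(1) k0 \<open>sum ?c E = 1\<close>
      by (intro imageI CollectI exI[of _ ?c]) auto
    finally show "y \<in> ?S" using a0 c(2) by blast
  qed
qed

section \<open>The cells of the two complexes\<close>

text \<open>
  Adding a multiple \<open>t\<close> of $e_B$ to \<open>v\<close> raises the weight of \<open>A\<close> by $t |A \cap B|$. With \<open>t\<close> the
  deficit of \<open>B\<close>, the basis \<open>B\<close> catches up with its neighbours $B - i + j$ of maximal weight,
  and no basis overtakes them. Hence a face of the local subdivision that comes from a
  $\Gamma(M_v)$ without the vertex $e_B$ also comes from one that has this vertex.
\<close>

lemma exchange_edges_tilt:
  assumes B: "B \<in> matroid_bases m p" and ne: "exchange_edges m p B v \<noteq> {}"
  obtains u where "B \<in> initial_bases m p u" "exchange_edges m p B u = exchange_edges m p B v"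
proof -
  obtain e where e: "e \<in> exchange_edges m p B v" using ne by blast
  define t where "t = weight p v (exchange B e) - weight p v B"
  define u where "u = v + t *\<^sub>R indicator_vec B"
  have m: "card A = m" if "A \<in> matroid_bases m p" for A using that by (rule card_matroid_bases)
  note eD = exchange_edgesD[OF e]
  have t0: "0 \<le> t" using initial_basesD(2)[OF eD(2) B] by (simp add: t_def)
  have w: "weight p u A = weight p v A + t * real (card (B \<inter> A))" for A
    by (simp add: weight_inner u_def inner_add_left indicator_vec_inner)
  have wB: "weight p u B = weight p v (exchange B e) + t * (real m - 1)"
    using m[OF B] by (simp add: w t_def algebra_simps)
  have wx: "weight p u (exchange B f) = weight p v (exchange B f) + t * (real m - 1)" if "f \<in> B \<times> - B" for f
    using indicator_vec_inner_exchange[OF that] m[OF B] by (simp add: w indicator_vec_inner)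
  have uB: "B \<in> initial_bases m p u"
    unfolding initial_bases_def
  proof (intro CollectI conjI ballI B)
    fix A assume A: "A \<in> matroid_bases m p"
    show "weight p u A \<le> weight p u B"
    proof (cases "A = B")
      case False
      have "\<not> B \<subseteq> A" using card_subset_eq[of A B] m[OF A] m[OF B] False by auto
      then have "card (B \<inter> A) < card B" by (intro psubset_card_mono) auto
      then have "real (card (B \<inter> A)) \<le> real m - 1" using m[OF B] by simp
      then have "t * real (card (B \<inter> A)) \<le> t * (real m - 1)" using t0 by (rule mult_left_mono)
      then show ?thesis using initial_basesD(2)[OF eD(2) A] w[of A] wB by linarith
    qed simp
  qed
  have "exchange B f \<in> initial_bases m p u \<longleftrightarrow> exchange B f \<in> initial_bases m p v" if f: "f \<in> B \<times> - B" for f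
  proof
    assume a: "exchange B f \<in> initial_bases m p u"
    show "exchange B f \<in> initial_bases m p v"
      using initial_bases_weight_eq[OF uB a] wB wx[OF f] initial_bases_weight_ge[OF eD(2) initial_basesD(1)[OF a]]
      by simp
  next
    assume a: "exchange B f \<in> initial_bases m p v"
    show "exchange B f \<in> initial_bases m p u"
      using initial_bases_weight_eq[OF eD(2) a] wB wx[OF f] initial_bases_weight_ge[OF uB initial_basesD(1)[OF a]]
      by simp
  qed
  then have "exchange_edges m p B u = exchange_edges m p B v" by (auto simp: exchange_edges_def)
  then show ?thesis using that uB by blast
qed

text \<open>
  Being a heaviest basis is a closed condition on \<open>v\<close>, so more bases become heaviest in the
  limit. Conversely, a point \<open>u\<close> of the first region is the limit of the open segment from \<open>w\<close>
  to \<open>u\<close>: weights are affine in the vector, so along the segment the heaviest bases are those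
  that are heaviest at both ends.
\<close>

lemma closure_initial_bases_region_subset_iff:
  assumes "initial_bases m p w \<noteq> {}"
  shows "closure {x. initial_bases m p x = initial_bases m p v} \<subseteq> closure {x. initial_bases m p x = initial_bases m p w}
    \<longleftrightarrow> initial_bases m p w \<subseteq> initial_bases m p v"
    (is "closure (?C v) \<subseteq> closure (?C w) \<longleftrightarrow> _")
proof
  assume sub: "closure (?C v) \<subseteq> closure (?C w)"
  show "initial_bases m p w \<subseteq> initial_bases m p v"
  proof
    fix A assume A: "A \<in> initial_bases m p w"
    have "weight p v A' \<le> weight p v A" if A': "A' \<in> matroid_bases m p" for A'
    proof -
      have "closed {x. weight p x A' \<le> weight p x A}"
        unfolding weight_def by (intro closed_Collect_le continuous_intros)
      moreover have "?C w \<subseteq> {x. weight p x A' \<le> weight p x A}"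
        using A A' initial_basesD(2) by blast
      ultimately have "closure (?C w) \<subseteq> {x. weight p x A' \<le> weight p x A}" by (rule closure_minimal[rotated])
      moreover have "v \<in> closure (?C w)" using sub closure_subset[of "?C v"] by blast
      ultimately show ?thesis by blast
    qed
    then show "A \<in> initial_bases m p v" using initial_basesD(1)[OF A] by (simp add: initial_bases_def)
  qed
next
  assume sub: "initial_bases m p w \<subseteq> initial_bases m p v"
  obtain C where C: "C \<in> initial_bases m p w" using assms by blast
  have seg: "open_segment u w \<subseteq> ?C w" if u: "u \<in> ?C v" for u
  proof
    fix x assume "x \<in> open_segment u w"
    then obtain t where t: "0 < t" "t < 1" "x = (1 - t) *\<^sub>R u + t *\<^sub>R w" by (auto simp: in_segment)
    have wt: "weight p x A = (1 - t) * weight p u A + t * weight p w A" for A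
      by (simp add: weight_inner t(3) inner_add_left algebra_simps)
    have sub': "initial_bases m p w \<subseteq> initial_bases m p u" using u sub by simp
    have "initial_bases m p x = initial_bases m p w"
    proof
      show "initial_bases m p w \<subseteq> initial_bases m p x"
      proof
        fix A assume A: "A \<in> initial_bases m p w"
        have "weight p x A' \<le> weight p x A" if "A' \<in> matroid_bases m p" for A'
          unfolding wt using t initial_basesD(2)[OF A that] initial_basesD(2)[OF subsetD[OF sub' A] that]
          by (intro add_mono mult_left_mono) auto
        then show "A \<in> initial_bases m p x" using initial_basesD(1)[OF A] by (simp add: initial_bases_def)
      qed
      show "initial_bases m p x \<subseteq> initial_bases m p w"
      proof
        fix A assume A: "A \<in> initial_bases m p x"
        note Ab = initial_basesD(1)[OF A]
        have "weight p x C \<le> weight p x A" using initial_basesD(2)[OF A initial_basesD(1)[OF C]] .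
        moreover have "(1 - t) * weight p u A \<le> (1 - t) * weight p u C"
          using t initial_basesD(2)[OF subsetD[OF sub' C] Ab] by (intro mult_left_mono) auto
        ultimately have "t * weight p w C \<le> t * weight p w A" unfolding wt by linarith
        then have "weight p w C \<le> weight p w A" using t by simp
        then show "A \<in> initial_bases m p w" using initial_bases_weight_ge[OF C Ab] by simp
      qed
    qed
    then show "x \<in> ?C w" by simp
  qed
  have "?C v \<subseteq> closure (?C w)"
  proof
    fix u assume u: "u \<in> ?C v"
    show "u \<in> closure (?C w)"
    proof (cases "u = w")
      case True
      then show ?thesis using closure_subset[of "?C w"] by blast
    next
      case False
      then have "u \<in> closure (open_segment u w)" by simp
      then show ?thesis using closure_mono[OF seg[OF u]] by blast
    qed
  qed
  then show "closure (?C v) \<subseteq> closure (?C w)" by (simp add: closure_minimal)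
qed

text \<open>
  The bijection sends \<open>K v\<close> to \<open>F v\<close>; it does not depend on the choice of \<open>v\<close>, since equality
  of sets is two inclusions.
\<close>

lemma combinatorially_dualI:
  assumes "\<And>v w. v \<in> V \<Longrightarrow> w \<in> V \<Longrightarrow> K v \<subseteq> K w \<longleftrightarrow> F w \<subseteq> F v"
  shows "combinatorially_dual (K ` V) (F ` V)"
proof -
  define f where "f C = F (SOME v. v \<in> V \<and> K v = C)" for C
  have f: "f (K v) = F v" if v: "v \<in> V" for v
  proof -
    let ?w = "SOME w. w \<in> V \<and> K w = K v"
    have w: "?w \<in> V \<and> K ?w = K v"
      using v by (intro someI[of "\<lambda>w. w \<in> V \<and> K w = K v"]) simp
    then have "F ?w = F v" using assms[of ?w v] assms[of v ?w] v by simp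
    then show ?thesis by (simp add: f_def)
  qed
  have "inj_on f (K ` V)"
  proof (rule inj_onI, clarify)
    fix v w assume vw: "v \<in> V" "w \<in> V" "f (K v) = f (K w)"
    then have "F v = F w" using f by simp
    then show "K v = K w" using assms[OF vw(1,2)] assms[OF vw(2,1)] by simp
  qed
  moreover have "f ` K ` V = F ` V" using f by (simp add: image_image)
  ultimately have "bij_betw f (K ` V) (F ` V)" by (simp add: bij_betw_def)
  moreover have "\<forall>C\<in>K ` V. \<forall>D\<in>K ` V. C \<subseteq> D \<longleftrightarrow> f D \<subseteq> f C"
    using f assms by simp
  ultimately show ?thesis unfolding combinatorially_dual_def by blast
qed

lemma local_tropical_linear_space_iff:
  assumes P: "tropical_pluecker m p"
  shows "v \<in> local_tropical_linear_space m p B \<longleftrightarrow>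
    B \<in> initial_bases m p v \<and> - B \<subseteq> snd ` exchange_edges m p B v"
  using ereal_vec_in_tropical_linear_space_iff[OF P]
  by (auto simp: local_tropical_linear_space_def basis_region_def)

text \<open>
  Membership in the local tropical linear space depends on $M_v$ only, so a
  cell is the closure of the set of all vectors with a given initial matroid.
\<close>

lemma local_cells_eq:
  assumes P: "tropical_pluecker m p"
  shows "local_cells m p B =
    (\<lambda>v. closure {x. initial_bases m p x = initial_bases m p v}) ` local_tropical_linear_space m p B"
proof -
  have "{x \<in> local_tropical_linear_space m p B. initial_bases m p x = initial_bases m p v}
      = {x. initial_bases m p x = initial_bases m p v}" if "v \<in> local_tropical_linear_space m p B" for v
    using that by (auto simp: local_tropical_linear_space_iff[OF P] exchange_edges_def)
  then show ?thesis unfolding local_cells_def Setcompr_eq_image by (intro image_cong refl) simp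
qed

text \<open>
  A nonempty slice of a face needs an exchange edge at every $j \notin B$. Together with the basis
  \<open>B\<close>, which a tilt along $e_B$ can supply, this is the description of the local tropical linear
  space.
\<close>

lemma mixed_subdivision_eq:
  fixes p :: "'n::finite set \<Rightarrow> ereal"
  assumes "m \<le> CARD('n)" and P: "tropical_pluecker m p" and B: "B \<in> matroid_bases m p"
  shows "mixed_subdivision m p B - {{}} =
    (\<lambda>v. mixed_cell B (exchange_edges m p B v)) ` local_tropical_linear_space m p B"
    (is "_ = ?F ` ?L")
proof (cases "m = CARD('n)")
  case True
  \<comment> \<open>With no element outside \<open>B\<close> both complexes consist of a single cell.\<close>
  have U: "A = UNIV" if "A \<in> matroid_bases m p" for A :: "'n set"
    using card_matroid_bases[OF that] True by (intro card_subset_eq) auto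
  have E: "exchange_edges m p B v = {}" for v
    using U[OF B] exchange_edges_subset[of m p B v] by auto
  have "B \<in> initial_bases m p v" for v using B U by (auto simp: initial_bases_def)
  then have "?L = UNIV" using U[OF B] by (auto simp: local_tropical_linear_space_iff[OF P])
  moreover have "mixed_cell B {} = {0}" using U[OF B] by (simp add: mixed_cell_def indicator_vec_def)
  moreover have "mixed_subdivision m p B = {{0}}" using True U[OF B] by (simp add: mixed_subdivision_def)
  ultimately show ?thesis by (auto simp: E)
next
  case False
  have BU: "B \<noteq> UNIV" using False card_matroid_bases[OF B] by auto
  have k: "real CARD('n) - real m = real (card (- B))"
    using assms(1) card_matroid_bases[OF B] by (simp add: Compl_eq_Diff_UNIV card_Diff_subset of_nat_diff)
  have "local_subdivision m p B =
      (\<lambda>v. convex hull ((\<lambda>e. indicator_vec (exchange B e)) ` exchange_edges m p B v)) ` UNIV"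
    unfolding local_subdivision_def regular_subdivision_def
    using matroid_polytope_Int_vertex_figure[OF P B] by auto
  then have "mixed_subdivision m p B = ?F ` UNIV"
    unfolding mixed_subdivision_def if_not_P[OF False] Setcompr_eq_image
    by (simp only: image_image cayley_slice_eq_mixed_cell[OF exchange_edges_subset BU k])
  moreover have "?F v \<in> ?F ` ?L" if "?F v \<noteq> {}" for v
  proof -
    have cov: "- B \<subseteq> snd ` exchange_edges m p B v"
      using that mixed_cell_nonempty_iff[OF exchange_edges_subset] by blast
    then have "exchange_edges m p B v \<noteq> {}" using BU by auto
    then obtain u where "B \<in> initial_bases m p u" "exchange_edges m p B u = exchange_edges m p B v"
      using exchange_edges_tilt[OF B] by blast
    then show ?thesis using cov by (intro image_eqI[of _ _ u]) (auto simp: local_tropical_linear_space_iff[OF P])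
  qed
  moreover have "?F v \<noteq> {}" if "v \<in> ?L" for v
    using that mixed_cell_nonempty_iff[OF exchange_edges_subset]
    by (auto simp: local_tropical_linear_space_iff[OF P])
  ultimately show ?thesis by auto
qed

theorem proposition3p1:
  fixes p :: "'n::finite set \<Rightarrow> ereal" and m :: nat and B :: "'n set"
  assumes "m \<le> CARD('n)"
    and "tropical_pluecker m p"
    and "B \<in> matroid_bases m p"
  shows "combinatorially_dual (local_cells m p B) (mixed_subdivision m p B - {{}})"
  unfolding local_cells_eq[OF assms(2)] mixed_subdivision_eq[OF assms]
proof (rule combinatorially_dualI)
  fix v w
  assume "v \<in> local_tropical_linear_space m p B" "w \<in> local_tropical_linear_space m p B"
  then have v: "B \<in> initial_bases m p v" and w: "B \<in> initial_bases m p w"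
    and cov: "- B \<subseteq> snd ` exchange_edges m p B w"
    by (auto simp: local_tropical_linear_space_iff[OF assms(2)])
  have "closure {x. initial_bases m p x = initial_bases m p v} \<subseteq> closure {x. initial_bases m p x = initial_bases m p w}
      \<longleftrightarrow> initial_bases m p w \<subseteq> initial_bases m p v"
    using w by (intro closure_initial_bases_region_subset_iff) auto
  also have "\<dots> \<longleftrightarrow> exchange_edges m p B w \<subseteq> exchange_edges m p B v"
    by (rule initial_bases_subset_iff[OF assms(2) v w])
  also have "\<dots> \<longleftrightarrow> mixed_cell B (exchange_edges m p B w) \<subseteq> mixed_cell B (exchange_edges m p B v)"
    by (rule mixed_cell_subset_iff[OF v w cov, symmetric])
  finally show "closure {x. initial_bases m p x = initial_bases m p v} \<subseteq> closure {x. initial_bases m p x = initial_bases m p w}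
      \<longleftrightarrow> mixed_cell B (exchange_edges m p B w) \<subseteq> mixed_cell B (exchange_edges m p B v)" .
qed

end
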